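(* Let $K \subset \mathbb{C}\subset\hat{\mathbb{C}}$ be a self-similar set. Then the hyperbolic volume of the hyperbolic convex hull $CH(K)\subset\mathbb{H}^3$ is either $0$ or $\infty$, and it is $0$ if and only if $K$ is contained in a circle in $\hat{\mathbb{C}}$.
   Context: A compact set $K\subset\mathbb{C}$ is called self-similar if there exists a finite set of contracting similarities $S_i:\mathbb{C}\to\mathbb{C}$, $1\le i\le N$ (maps of the Euclidean plane scaling all distances by a fixed ratio $r_i\in(0,1)$), such that $K=\bigcup_{i=1}^N S_i(K)$. $\mathbb{H}^3$ is hyperbolic 3-space, whose sphere at infinity is identified with the Riemann sphere $\hat{\mathbb{C}}=\mathbb{C}\cup\{\infty\}$. A circle in $\hat{\mathbb{C}}$ is a round circle in $\mathbb{C}$ or a Euclidean line in $\mathbb{C}$ together with $\infty$. For a closed set $E\subset\hat{\mathbb{C}}$, the hyperbolic convex hull $CH(E)\subset\mathbb{H}^3$ is the hyperbolic convex hull of the union of all hyperbolic geodesics in $\mathbb{H}^3$ both of whose endpoints at infinity lie in $E$ (so it is empty if $E$ has at most one point). *)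

theory Defs
  imports "HOL-Analysis.Analysis"
begin

section \<open>Self-similar sets\<close>

definition contracting_similarity :: "(complex \<Rightarrow> complex) \<Rightarrow> bool" where
  "contracting_similarity S \<longleftrightarrow>
     (\<exists>r::real. 0 < r \<and> r < 1 \<and> (\<forall>x y. dist (S x) (S y) = r * dist x y))"

definition self_similar :: "complex set \<Rightarrow> bool" where
  "self_similar K \<longleftrightarrow>
     compact K \<and>
     (\<exists>F. finite F \<and> (\<forall>S\<in>F. contracting_similarity S) \<and> K = (\<Union>S\<in>F. S ` K))"

section \<open>The Riemann sphere and its circles\<close>

text \<open>
  As for the Alexandroff compactification of the library, \<open>None\<close> is the point at infinity
  and a finite point \<open>a\<close> is \<open>Some a\<close>.
\<close>

type_synonym riemann_sphere = "complex option"

definition sphere_circle :: "riemann_sphere set \<Rightarrow> bool" where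
  "sphere_circle C \<longleftrightarrow>
     (\<exists>(c::complex) (r::real). 0 < r \<and> C = Some ` sphere c r) \<or>
     (\<exists>(a::complex) b. a \<noteq> b \<and> C = insert None (Some ` (affine hull {a, b})))"

section \<open>Hyperbolic 3-space\<close>

text \<open>
  Upper half-space model with metric \<open>(|dz|^2 + dt^2) / t^2\<close>: a point is a pair \<open>(z, t)\<close>
  with \<open>z\<close> complex and \<open>t > 0\<close>. The product metric on \<open>complex \<times> real\<close> is the Euclidean one,
  and \<open>lborel\<close> on this type is 3-dimensional Lebesgue measure.
\<close>

type_synonym point3 = "complex \<times> real"

definition hyp_space :: "point3 set" where
  "hyp_space = {p. 0 < snd p}"

definition hyp_dist :: "point3 \<Rightarrow> point3 \<Rightarrow> real" where
  "hyp_dist p q = arcosh (1 + (dist p q)\<^sup>2 / (2 * snd p * snd q))"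

definition hyp_measure :: "point3 measure" where
  "hyp_measure = density lborel (\<lambda>p. if p \<in> hyp_space then ennreal (1 / snd p ^ 3) else 0)"

definition hyp_volume :: "point3 set \<Rightarrow> ennreal" where
  "hyp_volume A = emeasure hyp_measure A"

definition hyp_segment :: "point3 \<Rightarrow> point3 \<Rightarrow> point3 set" where
  "hyp_segment p q = {x \<in> hyp_space. hyp_dist p x + hyp_dist x q = hyp_dist p q}"

definition hyp_convex :: "point3 set \<Rightarrow> bool" where
  "hyp_convex A \<longleftrightarrow> A \<subseteq> hyp_space \<and> (\<forall>p\<in>A. \<forall>q\<in>A. hyp_segment p q \<subseteq> A)"

definition hyp_geodesic :: "(real \<Rightarrow> point3) \<Rightarrow> bool" where
  "hyp_geodesic \<gamma> \<longleftrightarrow>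
     range \<gamma> \<subseteq> hyp_space \<and> (\<forall>s t. hyp_dist (\<gamma> s) (\<gamma> t) = \<bar>s - t\<bar>)"

text \<open>
  Convergence to a point of the sphere at infinity, in the one-point compactification of
  \<open>complex \<times> real\<close>, where the finite point \<open>a\<close> of the Riemann sphere sits at \<open>(a, 0)\<close>.
\<close>

definition tends_to_ideal :: "(real \<Rightarrow> point3) \<Rightarrow> riemann_sphere \<Rightarrow> real filter \<Rightarrow> bool" where
  "tends_to_ideal \<gamma> \<xi> F \<longleftrightarrow>
     (case \<xi> of
        None \<Rightarrow> filterlim \<gamma> at_infinity F
      | Some a \<Rightarrow> (\<gamma> \<longlongrightarrow> (a, 0)) F)"

definition geodesics_union :: "riemann_sphere set \<Rightarrow> point3 set" where
  "geodesics_union E =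
     \<Union> {range \<gamma> | \<gamma>. hyp_geodesic \<gamma> \<and>
           (\<exists>\<xi>\<in>E. \<exists>\<eta>\<in>E. tends_to_ideal \<gamma> \<xi> at_bot \<and> tends_to_ideal \<gamma> \<eta> at_top)}"

definition CH :: "riemann_sphere set \<Rightarrow> point3 set" where
  "CH E = hyp_convex hull (geodesics_union E)"

end

theory Submission
  imports Defs
begin

text \<open>
  The map \<open>(z, t) \<mapsto> (z, |z|\<^sup>2 + t\<^sup>2)\<close> turns hyperbolic segments of the upper half-space
  into Euclidean segments of the region above the paraboloid \<open>w = |z|\<^sup>2\<close>, hemispheres
  orthogonal to the boundary into planes, and the ideal point \<open>a\<close> into \<open>(a, |a|\<^sup>2)\<close>. Hence
  \<open>CH(K)\<close> is the preimage of the convex hull of the points \<open>(a, |a|\<^sup>2)\<close> with \<open>a \<in> K\<close>, which is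
  contained in a plane if and only if \<open>K\<close> is contained in a circle; then \<open>CH(K)\<close> lies in
  a sphere or a plane and is a null set. Otherwise \<open>CH(K)\<close> contains a ball. One of the
  contractions \<open>S\<close> extends to a hyperbolic isometry mapping \<open>CH(K)\<close> into itself, so the
  images of the ball under the iterates of \<open>S\<close> stay in \<open>CH(K)\<close>. Their volumes are bounded
  below while their heights tend to \<open>0\<close>, so continuity from above excludes a finite volume.
\<close>

section \<open>Hyperbolic segments in the paraboloid model\<close>

text \<open>
  A triple \<open>(z, w, u)\<close> with \<open>u \<noteq> 0\<close> represents the point \<open>(z / u, w / u)\<close> in homogeneous
  coordinates; the form vanishes exactly on the triples over the paraboloid.
\<close>

definition lorentz :: "complex \<times> real \<times> real \<Rightarrow> complex \<times> real \<times> real \<Rightarrow> real" where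
  "lorentz X Y = (fst (snd X) * snd (snd Y) + fst (snd Y) * snd (snd X)) / 2 - fst X \<bullet> fst Y"

lemma lorentz_commute: "lorentz X Y = lorentz Y X"
  by (simp add: lorentz_def inner_commute)

lemma lorentz_add_left: "lorentz (X + Y) Z = lorentz X Z + lorentz Y Z"
  by (simp add: lorentz_def inner_add_left algebra_simps add_divide_distrib)

lemma lorentz_scaleR_left: "lorentz (c *\<^sub>R X) Z = c * lorentz X Z"
  by (simp add: lorentz_def algebra_simps add_divide_distrib)

lemma lorentz_add_right: "lorentz Z (X + Y) = lorentz Z X + lorentz Z Y"
  by (metis lorentz_add_left lorentz_commute)

lemma lorentz_scaleR_right: "lorentz Z (c *\<^sub>R X) = c * lorentz Z X"
  by (metis lorentz_scaleR_left lorentz_commute)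

lemmas lorentz_bilinear =
  lorentz_add_left lorentz_add_right lorentz_scaleR_left lorentz_scaleR_right

text \<open>The passage from the upper half-space to the projective model whose absolute is a
  paraboloid. A point \<open>(a, 0)\<close> of the boundary plane lands on the paraboloid
  itself.\<close>

definition paraboloid :: "point3 \<Rightarrow> point3" where
  "paraboloid p = (fst p, (norm (fst p))\<^sup>2 + (snd p)\<^sup>2)"

text \<open>The representative of \<open>paraboloid p\<close> in homogeneous coordinates, scaled to
  have \<open>lorentz\<close> square 1: the hyperboloid model.\<close>

definition hyperboloid :: "point3 \<Rightarrow> complex \<times> real \<times> real" where
  "hyperboloid p = (1 / snd p) *\<^sub>R (fst p, (norm (fst p))\<^sup>2 + (snd p)\<^sup>2, 1)"

text \<open>The right-hand side is what \<open>hyp_dist\<close> puts under \<open>arcosh\<close>, so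
  distances are governed by a bilinear form.\<close>

lemma lorentz_hyperboloid:
  assumes "p \<in> hyp_space" "q \<in> hyp_space"
  shows "lorentz (hyperboloid p) (hyperboloid q) = 1 + (dist p q)\<^sup>2 / (2 * snd p * snd q)"
proof -
  obtain z t w s where pq: "p = (z, t)" "q = (w, s)" by (cases p; cases q)
  have pos: "t > 0" "s > 0" using assms pq by (auto simp: hyp_space_def)
  have d: "(dist p q)\<^sup>2 = (norm z)\<^sup>2 + (norm w)\<^sup>2 - 2 * (z \<bullet> w) + (t - s)\<^sup>2"
  proof -
    have "(dist z w)\<^sup>2 = (norm z)\<^sup>2 + (norm w)\<^sup>2 - 2 * (z \<bullet> w)"
      by (simp add: dist_norm power2_norm_eq_inner inner_diff_left inner_diff_right inner_commute)
    moreover have "(dist p q)\<^sup>2 = (dist z w)\<^sup>2 + (t - s)\<^sup>2"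
      by (simp add: pq dist_Pair_Pair dist_real_def)
    ultimately show ?thesis by simp
  qed
  show ?thesis
    unfolding d using pos
    by (simp add: pq lorentz_def hyperboloid_def field_simps power2_eq_square)
qed

lemma lorentz_hyperboloid_self [simp]:
  "p \<in> hyp_space \<Longrightarrow> lorentz (hyperboloid p) (hyperboloid p) = 1"
  by (simp add: lorentz_hyperboloid)

lemma lorentz_hyperboloid_ge_1:
  "p \<in> hyp_space \<Longrightarrow> q \<in> hyp_space \<Longrightarrow> 1 \<le> lorentz (hyperboloid p) (hyperboloid q)"
  by (simp add: lorentz_hyperboloid hyp_space_def)

lemma hyp_dist_eq_arcosh:
  "p \<in> hyp_space \<Longrightarrow> q \<in> hyp_space \<Longrightarrow>
     hyp_dist p q = arcosh (lorentz (hyperboloid p) (hyperboloid q))"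
  by (simp add: lorentz_hyperboloid hyp_dist_def)

text \<open>By the addition formula and the injectivity of \<open>cosh\<close> on nonnegative reals,
  equality in the triangle inequality becomes an algebraic identity.\<close>

lemma arcosh_add_eq_iff:
  fixes a b c :: real
  assumes "1 \<le> a" "1 \<le> b" "1 \<le> c"
  shows "arcosh a + arcosh b = arcosh c \<longleftrightarrow> a * b + sqrt (a\<^sup>2 - 1) * sqrt (b\<^sup>2 - 1) = c"
proof -
  have "cosh (arcosh a + arcosh b) = a * b + sqrt (a\<^sup>2 - 1) * sqrt (b\<^sup>2 - 1)"
    using assms by (simp add: cosh_add sinh_arcosh_real)
  moreover have "arcosh a + arcosh b = arcosh c \<longleftrightarrow> cosh (arcosh a + arcosh b) = cosh (arcosh c)"
    using assms by (metis add_nonneg_nonneg arcosh_cosh_real arcosh_nonneg_real)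
  ultimately show ?thesis
    using assms by simp
qed

text \<open>The Lorentz form is negative definite on the orthogonal complement of a timelike vector.\<close>

lemma lorentz_orthogonal_null:
  assumes "p \<in> hyp_space" "lorentz V (hyperboloid p) = 0" "lorentz V V = 0"
  shows "V = 0"
proof -
  obtain z t where p: "p = (z, t)" by (cases p)
  obtain v w u where V: "V = (v, w, u)" by (cases V)
  have t: "t > 0" using assms p by (auto simp: hyp_space_def)
  have "u * w = (norm v)\<^sup>2"
    using assms(3) by (simp add: V lorentz_def power2_norm_eq_inner)
  moreover have "w = 2 * (v \<bullet> z) - ((norm z)\<^sup>2 + t\<^sup>2) * u"
  proof -
    have "lorentz V (z, (norm z)\<^sup>2 + t\<^sup>2, 1) = 0"
      using assms(2) t unfolding hyperboloid_def lorentz_scaleR_right by (simp add: p)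
    then show ?thesis
      by (simp add: V lorentz_def algebra_simps)
  qed
  \<comment> \<open>Eliminating \<open>w\<close> from the two equations completes a square and
    leaves a sum of two squares.\<close>
  ultimately have "(norm (v - u *\<^sub>R z))\<^sup>2 + t\<^sup>2 * u\<^sup>2 = 0"
  proof -
    have "(norm (v - u *\<^sub>R z))\<^sup>2 = (norm v)\<^sup>2 - 2 * u * (v \<bullet> z) + u\<^sup>2 * (norm z)\<^sup>2"
      unfolding power2_norm_eq_inner
      by (simp add: inner_diff_left inner_diff_right inner_commute power2_eq_square)
    with \<open>u * w = _\<close> \<open>w = _\<close> show ?thesis by algebra
  qed
  then have "norm (v - u *\<^sub>R z) = 0" "t * u = 0"
    by (simp_all add: add_nonneg_eq_0_iff)
  then have "u = 0" "v = 0"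
    using t by auto
  with \<open>w = _\<close> show ?thesis
    by (simp add: V zero_prod_def)
qed

text \<open>Equality in the triangle inequality makes the three vectors on the hyperboloid linearly
  dependent, with coefficients of the right sign; dividing by the last coordinate gives a convex
  combination.\<close>

lemma hyp_segment_subset_paraboloid:
  assumes "p \<in> hyp_space" "q \<in> hyp_space" "x \<in> hyp_segment p q"
  shows "paraboloid x \<in> closed_segment (paraboloid p) (paraboloid q)"
proof -
  have x: "x \<in> hyp_space" using assms by (auto simp: hyp_segment_def)
  define X Y Z where "X = hyperboloid p" and "Y = hyperboloid x" and "Z = hyperboloid q"
  define A B c where "A = lorentz X Y" and "B = lorentz Y Z" and "c = lorentz X Z"
  define a b where "a = sqrt (A\<^sup>2 - 1)" and "b = sqrt (B\<^sup>2 - 1)"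
  have ge: "A \<ge> 1" "B \<ge> 1" "c \<ge> 1"
    using assms x by (simp_all add: A_def B_def c_def X_def Y_def Z_def lorentz_hyperboloid_ge_1)
  have "arcosh A + arcosh B = arcosh c"
    using assms x by (simp add: hyp_segment_def A_def B_def c_def X_def Y_def Z_def hyp_dist_eq_arcosh)
  then have c: "c = A * B + a * b"
    using ge by (simp add: arcosh_add_eq_iff a_def b_def)
  have ab: "a \<ge> 0" "b \<ge> 0" "a\<^sup>2 = A\<^sup>2 - 1" "b\<^sup>2 = B\<^sup>2 - 1"
    using ge by (simp_all add: a_def b_def)
  have self: "lorentz X X = 1" "lorentz Y Y = 1" "lorentz Z Z = 1"
    using assms x by (simp_all add: X_def Y_def Z_def)
  have lor: "lorentz X Y = A" "lorentz Y X = A" "lorentz Y Z = B" "lorentz Z Y = B"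
    "lorentz X Z = c" "lorentz Z X = c"
    by (simp_all add: A_def B_def c_def lorentz_commute)
  \<comment> \<open>\<open>V\<close> is orthogonal to \<open>Y\<close>, and equality in the triangle inequality makes it null.\<close>
  define V where "V = b *\<^sub>R X + a *\<^sub>R Z + (- (b * A + a * B)) *\<^sub>R Y"
  have "lorentz V Y = 0"
    unfolding V_def lorentz_bilinear lor self by simp
  moreover have "lorentz V V = a\<^sup>2 + b\<^sup>2 + 2 * a * b * c - (b * A + a * B)\<^sup>2"
    unfolding V_def lorentz_bilinear lor self by algebra
  moreover have "a\<^sup>2 + b\<^sup>2 + 2 * a * b * c - (b * A + a * B)\<^sup>2 = 0"
    using ab(3,4) c by algebra
  ultimately have "V = 0"
    using lorentz_orthogonal_null x by (simp add: Y_def)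
  obtain zp tp zq tq zx tx where eqs: "p = (zp, tp)" "q = (zq, tq)" "x = (zx, tx)"
    by (cases p; cases q; cases x)
  have pos: "tp > 0" "tq > 0" "tx > 0" using assms x eqs by (auto simp: hyp_space_def)
  \<comment> \<open>The coefficients of \<open>V = 0\<close> with respect to triples with last
    coordinate 1; that coordinate yields \<open>bp + aq = k\<close>, so \<open>bp / k\<close> and
    \<open>aq / k\<close> are barycentric weights.\<close>
  define k where "k = (b * A + a * B) / tx"
  define bp where "bp = b / tp"
  define aq where "aq = a / tq"
  have k: "bp + aq = k" "bp *\<^sub>R zp + aq *\<^sub>R zq = k *\<^sub>R zx"
    "bp * ((norm zp)\<^sup>2 + tp\<^sup>2) + aq * ((norm zq)\<^sup>2 + tq\<^sup>2) = k * ((norm zx)\<^sup>2 + tx\<^sup>2)"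
    using \<open>V = 0\<close>
    by (simp_all add: V_def X_def Y_def Z_def hyperboloid_def eqs zero_prod_def k_def bp_def aq_def
        algebra_simps add_divide_distrib diff_divide_distrib)
  show ?thesis
  proof (cases "k = 0")
    \<comment> \<open>The relation is void here, but \<open>a = 0\<close> means
      \<open>A = 1\<close>, that is \<open>x = p\<close>.\<close>
    case True
    have "bp \<ge> 0" "aq \<ge> 0" using ab pos by (auto simp: bp_def aq_def)
    with k(1) True have "aq = 0" by simp
    then have "a = 0" using pos by (simp add: aq_def)
    with ab ge have "A = 1"
      by (simp add: power2_eq_1_iff)
    then have "dist p x = 0"
      using lorentz_hyperboloid[OF assms(1) x] pos by (simp add: A_def X_def Y_def eqs)
    then show ?thesis by simp
  next
    case False
    have "bp \<ge> 0" "aq \<ge> 0" using ab pos by (auto simp: bp_def aq_def)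
    with k(1) False have kp: "k > 0" by linarith
    define u where "u = aq / k"
    have u: "0 \<le> u" "u \<le> 1" "1 - u = bp / k"
      using \<open>bp \<ge> 0\<close> \<open>aq \<ge> 0\<close> kp k(1) by (auto simp: u_def field_simps)
    have "(1 / k) *\<^sub>R (bp *\<^sub>R zp + aq *\<^sub>R zq) = zx"
      using kp k(2) by simp
    then have "zx = (1 - u) *\<^sub>R zp + u *\<^sub>R zq"
      unfolding u(3) by (simp add: u_def scaleR_add_right)
    moreover have "(norm zx)\<^sup>2 + tx\<^sup>2 = (1 - u) * ((norm zp)\<^sup>2 + tp\<^sup>2) + u * ((norm zq)\<^sup>2 + tq\<^sup>2)"
    proof -
      have "(norm zx)\<^sup>2 + tx\<^sup>2 = (k * ((norm zx)\<^sup>2 + tx\<^sup>2)) / k"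
        using kp by simp
      then show ?thesis
        unfolding k(3) [symmetric] u(3) by (simp add: u_def add_divide_distrib)
    qed
    ultimately have "paraboloid x = (1 - u) *\<^sub>R paraboloid p + u *\<^sub>R paraboloid q"
      by (simp add: paraboloid_def eqs)
    with u(1,2) show ?thesis
      unfolding closed_segment_def by blast
  qed
qed

text \<open>The middle vector is a nonnegative combination of the outer two, and since its
  \<open>lorentz\<close> square is 1 the identity of \<open>arcosh_add_eq_iff\<close>
  follows.\<close>

lemma paraboloid_closed_segment_subset:
  assumes "p \<in> hyp_space" "q \<in> hyp_space" "x \<in> hyp_space"
    and "paraboloid x \<in> closed_segment (paraboloid p) (paraboloid q)"
  shows "x \<in> hyp_segment p q"
proof -
  define X Y Z where "X = hyperboloid p" and "Y = hyperboloid x" and "Z = hyperboloid q"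
  define A B c where "A = lorentz X Y" and "B = lorentz Y Z" and "c = lorentz X Z"
  obtain zp tp zq tq zx tx where eqs: "p = (zp, tp)" "q = (zq, tq)" "x = (zx, tx)"
    by (cases p; cases q; cases x)
  have pos: "tp > 0" "tq > 0" "tx > 0" using assms eqs by (auto simp: hyp_space_def)
  obtain u where u: "0 \<le> u" "u \<le> 1" "paraboloid x = (1 - u) *\<^sub>R paraboloid p + u *\<^sub>R paraboloid q"
    using assms(4) unfolding closed_segment_def by blast
  \<comment> \<open>The weights \<open>1 - u\<close> and \<open>u\<close>, corrected by the heights
    that \<open>hyperboloid\<close> divides by.\<close>
  define \<alpha> \<beta> where "\<alpha> = (1 - u) * tp / tx" and "\<beta> = u * tq / tx"
  have nonneg: "\<alpha> \<ge> 0" "\<beta> \<ge> 0" using u pos by (auto simp: \<alpha>_def \<beta>_def)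
  have Y: "Y = \<alpha> *\<^sub>R X + \<beta> *\<^sub>R Z"
  proof -
    have "zx = (1 - u) *\<^sub>R zp + u *\<^sub>R zq"
      and w: "(norm zx)\<^sup>2 + tx\<^sup>2 = (1 - u) * ((norm zp)\<^sup>2 + tp\<^sup>2) + u * ((norm zq)\<^sup>2 + tq\<^sup>2)"
      using arg_cong[OF u(3), of fst] arg_cong[OF u(3), of snd] by (simp_all add: paraboloid_def eqs)
    then have "(1 / tx) *\<^sub>R zx = (\<alpha> / tp) *\<^sub>R zp + (\<beta> / tq) *\<^sub>R zq"
      using pos by (simp add: \<alpha>_def \<beta>_def scaleR_add_right)
    moreover have "((norm zx)\<^sup>2 + tx\<^sup>2) / tx =
        (\<alpha> / tp) * ((norm zp)\<^sup>2 + tp\<^sup>2) + (\<beta> / tq) * ((norm zq)\<^sup>2 + tq\<^sup>2)"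
      unfolding w using pos by (simp add: \<alpha>_def \<beta>_def add_divide_distrib)
    moreover have "1 / tx = \<alpha> / tp + \<beta> / tq"
      using pos by (simp add: \<alpha>_def \<beta>_def field_simps)
    moreover have "Y = ((1 / tx) *\<^sub>R zx, ((norm zx)\<^sup>2 + tx\<^sup>2) / tx, 1 / tx)"
      by (simp add: Y_def hyperboloid_def eqs)
    moreover have "\<alpha> *\<^sub>R X + \<beta> *\<^sub>R Z = ((\<alpha> / tp) *\<^sub>R zp + (\<beta> / tq) *\<^sub>R zq,
        (\<alpha> / tp) * ((norm zp)\<^sup>2 + tp\<^sup>2) + (\<beta> / tq) * ((norm zq)\<^sup>2 + tq\<^sup>2), \<alpha> / tp + \<beta> / tq)"
      by (simp add: X_def Z_def hyperboloid_def eqs)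
    ultimately show ?thesis by (simp only:)
  qed
  have ge: "A \<ge> 1" "B \<ge> 1" "c \<ge> 1"
    using assms by (simp_all add: A_def B_def c_def X_def Y_def Z_def lorentz_hyperboloid_ge_1)
  have self: "lorentz X X = 1" "lorentz Y Y = 1" "lorentz Z Z = 1"
    using assms by (simp_all add: X_def Y_def Z_def)
  have lor: "lorentz X Z = c" "lorentz Z X = c"
    by (simp_all add: c_def lorentz_commute)
  have A: "A = \<alpha> + \<beta> * c" and B: "B = \<alpha> * c + \<beta>"
    by (simp_all add: A_def B_def Y lorentz_bilinear lor self)
  have one: "\<alpha>\<^sup>2 + 2 * \<alpha> * \<beta> * c + \<beta>\<^sup>2 = 1"
    using self(2) unfolding Y lorentz_bilinear lor self by algebra
  \<comment> \<open>Both radicands are squares times \<open>c\<^sup>2 - 1\<close>, so the product of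
    the two roots is \<open>\<alpha> * \<beta> * (c\<^sup>2 - 1)\<close>.\<close>
  have "A\<^sup>2 - 1 = \<beta>\<^sup>2 * (c\<^sup>2 - 1)" "B\<^sup>2 - 1 = \<alpha>\<^sup>2 * (c\<^sup>2 - 1)"
    unfolding A B using one by algebra+
  then have "sqrt (A\<^sup>2 - 1) = \<beta> * sqrt (c\<^sup>2 - 1)" "sqrt (B\<^sup>2 - 1) = \<alpha> * sqrt (c\<^sup>2 - 1)"
    using nonneg by (simp_all add: real_sqrt_mult)
  moreover have "sqrt (c\<^sup>2 - 1) * sqrt (c\<^sup>2 - 1) = c\<^sup>2 - 1"
    using ge by simp
  ultimately have "A * B + sqrt (A\<^sup>2 - 1) * sqrt (B\<^sup>2 - 1) = c"
    unfolding A B using one by algebra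
  then have "arcosh A + arcosh B = arcosh c"
    using ge by (simp add: arcosh_add_eq_iff)
  then show ?thesis
    using assms by (simp add: hyp_segment_def A_def B_def c_def X_def Y_def Z_def hyp_dist_eq_arcosh)
qed

lemma continuous_on_paraboloid [continuous_intros]:
  "continuous_on S f \<Longrightarrow> continuous_on S (\<lambda>x. paraboloid (f x))"
  unfolding paraboloid_def by (intro continuous_intros)

lemma tendsto_paraboloid [tendsto_intros]:
  "(f \<longlongrightarrow> l) F \<Longrightarrow> ((\<lambda>x. paraboloid (f x)) \<longlongrightarrow> paraboloid l) F"
  unfolding paraboloid_def by (intro tendsto_intros)

section \<open>Geodesics between ideal points\<close>

text \<open>A point of a geodesic lies on the segments from \<open>\<gamma> (- n)\<close> to
  \<open>\<gamma> n\<close> for large \<open>n\<close>; in the paraboloid model this passes to the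
  limit, so geodesics need not be classified.\<close>

lemma geodesics_union_subset:
  "geodesics_union (Some ` K) \<subseteq>
     {x \<in> hyp_space. \<exists>a\<in>K. \<exists>b\<in>K. paraboloid x \<in> closed_segment (paraboloid (a, 0)) (paraboloid (b, 0))}"
proof
  fix x assume "x \<in> geodesics_union (Some ` K)"
  then obtain \<gamma> s a b where g: "hyp_geodesic \<gamma>" "x = \<gamma> s" "a \<in> K" "b \<in> K"
    and lim: "(\<gamma> \<longlongrightarrow> (a, 0)) at_bot" "(\<gamma> \<longlongrightarrow> (b, 0)) at_top"
    unfolding geodesics_union_def tends_to_ideal_def by auto
  have H: "\<gamma> t \<in> hyp_space" for t using g unfolding hyp_geodesic_def by auto
  \<comment> \<open>Lying on a segment is written as an equality of Euclidean distances, which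
    survives the limit.\<close>
  have "dist (paraboloid (\<gamma> (- n))) (paraboloid (\<gamma> n)) =
      dist (paraboloid (\<gamma> (- n))) (paraboloid x) + dist (paraboloid x) (paraboloid (\<gamma> n))"
    if "n \<ge> \<bar>s\<bar>" for n
  proof -
    have "x \<in> hyp_segment (\<gamma> (- n)) (\<gamma> n)"
      using g H that by (auto simp: hyp_segment_def hyp_geodesic_def)
    then have "paraboloid x \<in> closed_segment (paraboloid (\<gamma> (- n))) (paraboloid (\<gamma> n))"
      using H hyp_segment_subset_paraboloid by blast
    then show ?thesis
      by (simp add: between_mem_segment [symmetric] between)
  qed
  then have ev: "\<forall>\<^sub>F n in at_top. dist (paraboloid (\<gamma> (- n))) (paraboloid (\<gamma> n)) =
      dist (paraboloid (\<gamma> (- n))) (paraboloid x) + dist (paraboloid x) (paraboloid (\<gamma> n))"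
    using eventually_ge_at_top by (rule eventually_mono[rotated])
  have lim': "((\<lambda>n. \<gamma> (- n)) \<longlongrightarrow> (a, 0)) at_top"
    using lim(1) by (simp add: filterlim_at_bot_mirror)
  have "((\<lambda>n. dist (paraboloid (\<gamma> (- n))) (paraboloid (\<gamma> n))) \<longlongrightarrow>
      dist (paraboloid (a, 0)) (paraboloid (b, 0))) at_top"
    by (intro tendsto_intros lim lim')
  moreover have "((\<lambda>n. dist (paraboloid (\<gamma> (- n))) (paraboloid (\<gamma> n))) \<longlongrightarrow>
      dist (paraboloid (a, 0)) (paraboloid x) + dist (paraboloid x) (paraboloid (b, 0))) at_top"
    unfolding tendsto_cong[OF ev] by (intro tendsto_intros lim lim')
  ultimately have "dist (paraboloid (a, 0)) (paraboloid (b, 0)) =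
      dist (paraboloid (a, 0)) (paraboloid x) + dist (paraboloid x) (paraboloid (b, 0))"
    by (intro tendsto_unique) auto
  then show "x \<in> {x \<in> hyp_space. \<exists>a\<in>K. \<exists>b\<in>K.
      paraboloid x \<in> closed_segment (paraboloid (a, 0)) (paraboloid (b, 0))}"
    using g H by (auto simp: between_mem_segment [symmetric] between)
qed

text \<open>The unit speed parametrization of the semicircle over the diameter from
  \<open>m - e\<close> to \<open>m + e\<close>: the argument of \<open>arcosh\<close> reduces to
  \<open>cosh (s - t)\<close>.\<close>

lemma hyp_dist_semicircle:
  fixes e m :: complex
  assumes "e \<noteq> 0"
  shows "hyp_dist (m + tanh s *\<^sub>R e, norm e / cosh s) (m + tanh t *\<^sub>R e, norm e / cosh t) = \<bar>s - t\<bar>"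
proof -
  have ne: "cosh s \<noteq> 0" "cosh t \<noteq> 0" by (simp_all add: cosh_real_nonzero)
  have d: "(dist (m + tanh s *\<^sub>R e, norm e / cosh s) (m + tanh t *\<^sub>R e, norm e / cosh t))\<^sup>2 =
      (norm e)\<^sup>2 * ((tanh s - tanh t)\<^sup>2 + (1 / cosh s - 1 / cosh t)\<^sup>2)"
  proof -
    have "dist (m + tanh s *\<^sub>R e) (m + tanh t *\<^sub>R e) = \<bar>tanh s - tanh t\<bar> * norm e"
      by (metis add_diff_cancel_left dist_norm norm_scaleR scaleR_left_diff_distrib)
    moreover have "norm e / cosh s - norm e / cosh t = norm e * (1 / cosh s - 1 / cosh t)"
      by (simp add: algebra_simps)
    ultimately show ?thesis
      unfolding dist_Pair_Pair dist_real_def by (simp add: power_mult_distrib distrib_left)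
  qed
  have "1 + (norm e)\<^sup>2 * ((tanh s - tanh t)\<^sup>2 + (1 / cosh s - 1 / cosh t)\<^sup>2) /
      (2 * (norm e / cosh s) * (norm e / cosh t)) =
      1 + ((tanh s - tanh t)\<^sup>2 + (1 / cosh s - 1 / cosh t)\<^sup>2) * cosh s * cosh t / 2"
    using assms ne by (simp add: power2_eq_square)
  also have "\<dots> = cosh s * cosh t - sinh s * sinh t"
  proof -
    \<comment> \<open>Denominators are cleared with the factor \<open>cosh s * cosh t\<close>; then
      \<open>hyperbolic_pythagoras\<close> removes the squares.\<close>
    have "(tanh s - tanh t) * (cosh s * cosh t) = sinh s * cosh t - sinh t * cosh s"
      "(1 / cosh s - 1 / cosh t) * (cosh s * cosh t) = cosh t - cosh s"
      using ne by (simp_all add: tanh_def left_diff_distrib)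
    then have "(tanh s - tanh t)\<^sup>2 * (cosh s * cosh t)\<^sup>2 = (sinh s * cosh t - sinh t * cosh s)\<^sup>2"
      "(1 / cosh s - 1 / cosh t)\<^sup>2 * (cosh s * cosh t)\<^sup>2 = (cosh t - cosh s)\<^sup>2"
      by (metis power_mult_distrib)+
    then have "((tanh s - tanh t)\<^sup>2 + (1 / cosh s - 1 / cosh t)\<^sup>2) * (cosh s * cosh t)\<^sup>2 =
        (sinh s * cosh t - sinh t * cosh s)\<^sup>2 + (cosh t - cosh s)\<^sup>2"
      by (simp add: distrib_right)
    also have "\<dots> = 2 * (cosh s * cosh t) * (cosh s * cosh t - sinh s * sinh t - 1)"
      using hyperbolic_pythagoras[of s] hyperbolic_pythagoras[of t] by algebra
    finally have "((tanh s - tanh t)\<^sup>2 + (1 / cosh s - 1 / cosh t)\<^sup>2) * (cosh s * cosh t) =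
        2 * (cosh s * cosh t - sinh s * sinh t - 1)"
      using ne by (simp add: power2_eq_square)
    then show ?thesis by (simp add: mult.assoc diff_divide_distrib)
  qed
  also have "\<dots> = cosh \<bar>s - t\<bar>"
    by (cases "s \<ge> t") (simp_all add: cosh_diff mult.commute)
  finally show ?thesis
    unfolding hyp_dist_def d snd_conv by (simp only: arcosh_cosh_real[OF abs_ge_zero])
qed

lemma geodesics_unionI:
  assumes "hyp_geodesic \<gamma>" "a \<in> K" "b \<in> K"
    and "(\<gamma> \<longlongrightarrow> (a, 0)) at_bot" "(\<gamma> \<longlongrightarrow> (b, 0)) at_top"
  shows "\<gamma> s \<in> geodesics_union (Some ` K)"
  unfolding geodesics_union_def
proof (rule UnionI)
  show "\<gamma> s \<in> range \<gamma>" by (rule rangeI)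
  have "tends_to_ideal \<gamma> (Some a) at_bot" "tends_to_ideal \<gamma> (Some b) at_top"
    using assms(4,5) by (simp_all add: tends_to_ideal_def)
  then show "range \<gamma> \<in> {range \<gamma> |\<gamma>. hyp_geodesic \<gamma> \<and>
      (\<exists>\<xi>\<in>Some ` K. \<exists>\<eta>\<in>Some ` K. tends_to_ideal \<gamma> \<xi> at_bot \<and> tends_to_ideal \<gamma> \<eta> at_top)}"
    using assms(1-3) by blast
qed

text \<open>Open chords of the paraboloid are the images of semicircles, so the point is found on an
  explicit one.\<close>

lemma open_segment_subset_geodesics_union:
  assumes "a \<in> K" "b \<in> K" "x \<in> hyp_space"
    and "paraboloid x \<in> open_segment (paraboloid (a, 0)) (paraboloid (b, 0))"
  shows "x \<in> geodesics_union (Some ` K)"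
proof -
  obtain z t where x: "x = (z, t)" by (cases x)
  have t: "t > 0" using assms x by (simp add: hyp_space_def)
  obtain u where u: "0 < u" "u < 1"
    and xu: "paraboloid x = (1 - u) *\<^sub>R paraboloid (a, 0) + u *\<^sub>R paraboloid (b, 0)"
    and "a \<noteq> b"
    using assms(4) by (auto simp: in_segment)
  \<comment> \<open>Half the diameter and the midpoint, so that the ends \<open>m - e\<close> and
    \<open>m + e\<close> are \<open>a\<close> and \<open>b\<close>.\<close>
  define e m where "e = (1/2) *\<^sub>R (b - a)" and "m = (1/2) *\<^sub>R (a + b)"
  have e: "e \<noteq> 0" using \<open>a \<noteq> b\<close> by (simp add: e_def)
  define \<gamma> where "\<gamma> = (\<lambda>s. (m + tanh s *\<^sub>R e, norm e / cosh s))"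
  have "hyp_geodesic \<gamma>"
    using e by (auto simp: hyp_geodesic_def \<gamma>_def hyp_dist_semicircle hyp_space_def cosh_real_pos)
  have ch: "filterlim (cosh :: real \<Rightarrow> real) at_top at_top" "filterlim (cosh :: real \<Rightarrow> real) at_top at_bot"
    by (simp_all add: cosh_real_at_top cosh_real_at_bot)
  have "((\<lambda>s. norm e / cosh s) \<longlongrightarrow> 0) at_top" "((\<lambda>s. norm e / cosh s) \<longlongrightarrow> 0) at_bot"
    using ch by (auto intro!: real_tendsto_divide_at_top tendsto_const)
  moreover have "((\<lambda>s. m + tanh s *\<^sub>R e) \<longlongrightarrow> m + 1 *\<^sub>R e) at_top"
     "((\<lambda>s. m + tanh s *\<^sub>R e) \<longlongrightarrow> m + (-1) *\<^sub>R e) at_bot"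
    by (intro tendsto_intros tanh_real_at_top tanh_real_at_bot)+
  moreover have "m + 1 *\<^sub>R e = b" "m + (-1) *\<^sub>R e = a"
    by (simp_all add: m_def e_def complex_eq_iff field_simps)
  ultimately have lim: "(\<gamma> \<longlongrightarrow> (a, 0)) at_bot" "(\<gamma> \<longlongrightarrow> (b, 0)) at_top"
    unfolding \<gamma>_def by (auto intro!: tendsto_Pair)
  \<comment> \<open>Solves \<open>tanh s = 2 * u - 1\<close>, the parameter of the chord carried
    from (0,1) to (-1,1).\<close>
  define s where "s = ln (sqrt (u / (1 - u)))"
  have ts: "tanh s = 2 * u - 1"
    unfolding s_def using u by (subst tanh_ln_real) (auto simp: field_simps)
  have z: "z = (1 - u) *\<^sub>R a + u *\<^sub>R b"
    and w: "(norm z)\<^sup>2 + t\<^sup>2 = (1 - u) * (norm a)\<^sup>2 + u * (norm b)\<^sup>2"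
    using arg_cong[OF xu, of fst] arg_cong[OF xu, of snd] by (simp_all add: x paraboloid_def)
  have z': "z = m + tanh s *\<^sub>R e"
    unfolding ts z by (simp add: m_def e_def complex_eq_iff field_simps)
  have "t\<^sup>2 = u * (1 - u) * (norm (b - a))\<^sup>2"
    using w unfolding z power2_norm_eq_inner
    by (simp add: inner_add_left inner_add_right inner_diff_left inner_diff_right inner_commute
        algebra_simps power2_eq_square)
  also have "\<dots> = (norm e)\<^sup>2 * (4 * u * (1 - u))"
    by (simp add: e_def norm_minus_commute power_divide)
  also have "4 * u * (1 - u) = 1 - (tanh s)\<^sup>2"
    unfolding ts by algebra
  also have "1 - (tanh s)\<^sup>2 = (1 / cosh s)\<^sup>2"
  proof -
    have "1 - (tanh s)\<^sup>2 = ((cosh s)\<^sup>2 - (sinh s)\<^sup>2) / (cosh s)\<^sup>2"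
      by (simp add: tanh_def power_divide diff_divide_distrib)
    then show ?thesis
      by (simp add: hyperbolic_pythagoras power_divide)
  qed
  finally have "t\<^sup>2 = (norm e / cosh s)\<^sup>2"
    by (simp add: power_divide)
  then have "t = norm e / cosh s"
    using t by (simp add: cosh_real_nonneg power2_eq_iff_nonneg)
  with z' have "x = \<gamma> s" by (simp add: x \<gamma>_def)
  then show ?thesis
    using geodesics_unionI[OF \<open>hyp_geodesic \<gamma>\<close> assms(1,2) lim] by simp
qed


section \<open>The hull of a set of ideal points\<close>

text \<open>Vertical height over the paraboloid: positive exactly on the image of
  \<open>hyp_space\<close>, and 0 at the ideal points.\<close>

definition depth :: "point3 \<Rightarrow> real" where
  "depth y = snd y - (norm (fst y))\<^sup>2"

lemma depth_paraboloid [simp]: "depth (paraboloid x) = (snd x)\<^sup>2"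
  by (simp add: depth_def paraboloid_def)

text \<open>The last term measures the strict convexity of the squared norm; it makes
  \<open>depth\<close> concave and puts open chords strictly above the paraboloid.\<close>

lemma depth_convex_combination:
  "depth ((1 - u) *\<^sub>R x + u *\<^sub>R y) =
     (1 - u) * depth x + u * depth y + u * (1 - u) * (norm (fst x - fst y))\<^sup>2"
proof -
  have "(norm ((1 - u) *\<^sub>R fst x + u *\<^sub>R fst y))\<^sup>2 =
      (1 - u)\<^sup>2 * (norm (fst x))\<^sup>2 + 2 * u * (1 - u) * (fst x \<bullet> fst y) + u\<^sup>2 * (norm (fst y))\<^sup>2"
    unfolding power2_norm_eq_inner
    by (simp add: inner_add_left inner_add_right inner_commute power2_eq_square)
  moreover have "(norm (fst x - fst y))\<^sup>2 = (norm (fst x))\<^sup>2 - 2 * (fst x \<bullet> fst y) + (norm (fst y))\<^sup>2"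
    unfolding power2_norm_eq_inner by (simp add: inner_diff_left inner_diff_right inner_commute)
  moreover have "snd ((1 - u) *\<^sub>R x + u *\<^sub>R y) = (1 - u) * snd x + u * snd y"
    "fst ((1 - u) *\<^sub>R x + u *\<^sub>R y) = (1 - u) *\<^sub>R fst x + u *\<^sub>R fst y"
    by simp_all
  ultimately show ?thesis
    unfolding depth_def by (simp only:) (simp add: algebra_simps power2_eq_square)
qed

lemma convex_depth_nonneg: "convex {y. 0 \<le> depth y}"
  unfolding convex_alt by (auto simp: depth_convex_combination)

lemma convex_depth_pos: "convex {y. 0 < depth y}"
  unfolding convex_alt
proof (intro ballI allI impI)
  fix x y :: point3 and u :: real
  assume xy: "x \<in> {y. 0 < depth y}" "y \<in> {y. 0 < depth y}" and u: "0 \<le> u \<and> u \<le> 1"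
  then have "0 < (1 - u) * depth x + u * depth y"
    by (smt (verit) mem_Collect_eq mult_nonneg_nonneg mult_pos_pos)
  moreover have "0 \<le> u * (1 - u) * (norm (fst x - fst y))\<^sup>2"
    using u by simp
  ultimately show "(1 - u) *\<^sub>R x + u *\<^sub>R y \<in> {y. 0 < depth y}"
    unfolding mem_Collect_eq depth_convex_combination by linarith
qed

lemma depth_posE:
  assumes "0 < depth y"
  obtains x where "x \<in> hyp_space" "paraboloid x = y"
proof
  show "(fst y, sqrt (depth y)) \<in> hyp_space"
    using assms by (simp add: hyp_space_def)
  show "paraboloid (fst y, sqrt (depth y)) = y"
    using assms by (simp add: paraboloid_def depth_def)
qed

lemma inj_on_paraboloid: "inj_on paraboloid hyp_space"
  by (intro inj_onI) (auto simp: paraboloid_def hyp_space_def prod_eq_iff power2_eq_iff)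

lemma hyp_convex_paraboloid_vimage:
  assumes "convex C"
  shows "hyp_convex {x \<in> hyp_space. paraboloid x \<in> C}"
  unfolding hyp_convex_def
proof (intro conjI ballI subsetI)
  fix p q x
  assume pq: "p \<in> {x \<in> hyp_space. paraboloid x \<in> C}" "q \<in> {x \<in> hyp_space. paraboloid x \<in> C}"
    and x: "x \<in> hyp_segment p q"
  then have "paraboloid x \<in> closed_segment (paraboloid p) (paraboloid q)"
    using hyp_segment_subset_paraboloid by blast
  then have "paraboloid x \<in> C"
    using pq assms convex_contains_segment by blast
  then show "x \<in> {x \<in> hyp_space. paraboloid x \<in> C}"
    using x by (simp add: hyp_segment_def)
qed auto

section \<open>Euclidean convexity of the image of the hyperbolic hull\<close>

lemma geodesics_union_subset_hyp_space: "geodesics_union E \<subseteq> hyp_space"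
  unfolding geodesics_union_def hyp_geodesic_def by blast

lemma hyp_convex_CH: "hyp_convex (CH E)"
proof -
  have "CH E \<subseteq> hyp_space"
    unfolding CH_def
    by (rule hull_minimal)
      (auto simp: geodesics_union_subset_hyp_space hyp_convex_def hyp_segment_def)
  then show ?thesis
    unfolding hyp_convex_def CH_def hull_def by blast
qed

lemma CH_subset_hyp_space: "CH E \<subseteq> hyp_space"
  using hyp_convex_CH hyp_convex_def by blast

text \<open>Segments stay at positive depth, hence pull back to hyperbolic segments, which
  \<open>CH E\<close> contains.\<close>

lemma convex_paraboloid_CH: "convex (paraboloid ` CH E)"
  unfolding convex_contains_segment
proof (intro ballI subsetI)
  fix x y r assume "x \<in> paraboloid ` CH E" "y \<in> paraboloid ` CH E" and r: "r \<in> closed_segment x y"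
  then obtain p q where pq: "p \<in> CH E" "q \<in> CH E" "x = paraboloid p" "y = paraboloid q" by auto
  then have H: "p \<in> hyp_space" "q \<in> hyp_space" using CH_subset_hyp_space by auto
  then have "0 < depth x" "0 < depth y" using pq by (auto simp: hyp_space_def)
  then have "0 < depth r"
    using convex_depth_pos r unfolding convex_contains_segment by blast
  then obtain s where s: "s \<in> hyp_space" "paraboloid s = r" by (rule depth_posE)
  then have "s \<in> hyp_segment p q"
    using paraboloid_closed_segment_subset H r pq by blast
  then show "r \<in> paraboloid ` CH E"
    using hyp_convex_CH pq s unfolding hyp_convex_def by blast
qed

abbreviation ideal :: "complex \<Rightarrow> point3" where
  "ideal a \<equiv> paraboloid (a, 0)"

lemma open_segment_ideal_subset_CH:
  assumes "a \<in> K" "b \<in> K"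
  shows "open_segment (ideal a) (ideal b) \<subseteq> paraboloid ` CH (Some ` K)"
proof
  fix r assume r: "r \<in> open_segment (ideal a) (ideal b)"
  then obtain u where u: "0 < u" "u < 1" "r = (1 - u) *\<^sub>R ideal a + u *\<^sub>R ideal b" "a \<noteq> b"
    by (auto simp: in_segment)
  \<comment> \<open>Both ends have depth 0, so only the cross term remains, positive since
    \<open>a\<close> and \<open>b\<close> differ.\<close>
  then have "0 < depth r"
    by (simp add: depth_convex_combination) (simp add: paraboloid_def)
  then obtain s where s: "s \<in> hyp_space" "paraboloid s = r" by (rule depth_posE)
  then have "s \<in> geodesics_union (Some ` K)"
    using open_segment_subset_geodesics_union assms r by blast
  then have "s \<in> CH (Some ` K)"
    unfolding CH_def by (rule hull_inc)
  then show "r \<in> paraboloid ` CH (Some ` K)"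
    unfolding s(2) [symmetric] by (rule imageI)
qed

text \<open>Ideal points lie outside the image of \<open>CH\<close>, so its convexity does not reach
  them. Minimality of the hull is applied to the set \<open>T\<close> of points whose proper convex
  combinations with \<open>ideal a\<close> stay in the image.\<close>

lemma open_segment_ideal_CH_subset:
  assumes "a \<in> K" "r \<in> paraboloid ` CH (Some ` K)"
  shows "open_segment (ideal a) r \<subseteq> paraboloid ` CH (Some ` K)"
proof -
  let ?C = "paraboloid ` CH (Some ` K)"
  have chord: "(1 - u) *\<^sub>R ideal b + u *\<^sub>R ideal c \<in> ?C"
    if "b \<in> K" "c \<in> K" "b \<noteq> c" "0 < u" "u < 1" for b c u
  proof -
    have "ideal b \<noteq> ideal c" using that by (simp add: paraboloid_def)
    then have "(1 - u) *\<^sub>R ideal b + u *\<^sub>R ideal c \<in> open_segment (ideal b) (ideal c)"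
      using that(4,5) unfolding in_segment by blast
    then show ?thesis
      using open_segment_ideal_subset_CH[OF that(1,2)] by blast
  qed
  define T where "T = {y. \<forall>u. 0 < u \<and> u < 1 \<longrightarrow> (1 - u) *\<^sub>R ideal a + u *\<^sub>R y \<in> ?C}"
  have "convex T"
    unfolding convex_alt
  proof (intro ballI allI impI)
    fix x y v assume xy: "x \<in> T" "y \<in> T" and v: "0 \<le> v \<and> v \<le> (1::real)"
    have "(1 - u) *\<^sub>R ideal a + u *\<^sub>R ((1 - v) *\<^sub>R x + v *\<^sub>R y) \<in> ?C" if "0 < u" "u < 1" for u
    proof -
      have "(1 - v) *\<^sub>R ((1 - u) *\<^sub>R ideal a + u *\<^sub>R x) + v *\<^sub>R ((1 - u) *\<^sub>R ideal a + u *\<^sub>R y) \<in> ?C"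
        using convex_paraboloid_CH[of "Some ` K"] xy v that unfolding convex_alt T_def by blast
      moreover have "(1 - v) *\<^sub>R ((1 - u) *\<^sub>R ideal a + u *\<^sub>R x) + v *\<^sub>R ((1 - u) *\<^sub>R ideal a + u *\<^sub>R y) =
          (1 - u) *\<^sub>R ideal a + u *\<^sub>R ((1 - v) *\<^sub>R x + v *\<^sub>R y)"
        by (simp add: algebra_simps)
      ultimately show ?thesis by simp
    qed
    then show "(1 - v) *\<^sub>R x + v *\<^sub>R y \<in> T" by (simp add: T_def)
  qed
  have "geodesics_union (Some ` K) \<subseteq> {x \<in> hyp_space. paraboloid x \<in> T}"
  proof
    fix x assume "x \<in> geodesics_union (Some ` K)"
    then obtain b c where x: "x \<in> hyp_space" and bc: "b \<in> K" "c \<in> K"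
      and seg: "paraboloid x \<in> closed_segment (ideal b) (ideal c)"
      using geodesics_union_subset by blast
    from seg obtain v where v: "0 \<le> v" "v \<le> 1" "paraboloid x = (1 - v) *\<^sub>R ideal b + v *\<^sub>R ideal c"
      by (auto simp: in_segment)
    \<comment> \<open>Positive depth rules out a degenerate chord and the ends of the chord.\<close>
    have "0 < depth (paraboloid x)" using x by (simp add: hyp_space_def)
    then have "0 < v * (1 - v) * (norm (b - c))\<^sup>2"
      unfolding v(3) depth_convex_combination by (simp add: paraboloid_def depth_def)
    then have "v \<noteq> 0" "v \<noteq> 1" "b \<noteq> c" by auto
    with v have v': "0 < v" "v < 1" by auto
    have "(1 - u) *\<^sub>R ideal a + u *\<^sub>R paraboloid x \<in> ?C" if u: "0 < u" "u < 1" for u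
    proof -
      \<comment> \<open>If \<open>a\<close> is an end of the chord, the point lies on that same
        chord; otherwise it combines points of the chords from \<open>a\<close> to \<open>b\<close>
        and from \<open>a\<close> to \<open>c\<close>.\<close>
      consider "a = b" | "a = c" | "a \<noteq> b" "a \<noteq> c" by blast
      then show ?thesis
      proof cases
        case 1
        have "(1 - u) *\<^sub>R ideal a + u *\<^sub>R paraboloid x = (1 - u * v) *\<^sub>R ideal b + (u * v) *\<^sub>R ideal c"
          unfolding v(3) 1 by (simp add: algebra_simps)
        moreover have "0 < u * v" "u * v < 1" using u v' mult_strict_mono[of u 1 v 1] by auto
        ultimately show ?thesis using chord[OF bc \<open>b \<noteq> c\<close>, of "u * v"] by simp
      next
        case 2
        have "(1 - u) *\<^sub>R ideal a + u *\<^sub>R paraboloid x =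
            (1 - u * (1 - v)) *\<^sub>R ideal c + (u * (1 - v)) *\<^sub>R ideal b"
          unfolding v(3) 2 by (simp add: algebra_simps)
        moreover have "0 < u * (1 - v)" "u * (1 - v) < 1"
          using u v' mult_strict_mono[of u 1 "1 - v" 1] by auto
        ultimately show ?thesis
          using chord[OF bc(2,1) \<open>b \<noteq> c\<close>[symmetric], of "u * (1 - v)"] by simp
      next
        case 3
        have "(1 - u) *\<^sub>R ideal a + u *\<^sub>R paraboloid x =
            (1 - v) *\<^sub>R ((1 - u) *\<^sub>R ideal a + u *\<^sub>R ideal b) + v *\<^sub>R ((1 - u) *\<^sub>R ideal a + u *\<^sub>R ideal c)"
          unfolding v(3) by (simp add: algebra_simps)
        moreover have "(1 - u) *\<^sub>R ideal a + u *\<^sub>R ideal b \<in> ?C" "(1 - u) *\<^sub>R ideal a + u *\<^sub>R ideal c \<in> ?C"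
          using chord assms(1) bc 3 u by auto
        ultimately show ?thesis
          by (metis convexD_alt convex_paraboloid_CH v(1,2))
      qed
    qed
    with x show "x \<in> {x \<in> hyp_space. paraboloid x \<in> T}" by (simp add: T_def)
  qed
  then have "CH (Some ` K) \<subseteq> {x \<in> hyp_space. paraboloid x \<in> T}"
    unfolding CH_def by (rule hull_minimal) (rule hyp_convex_paraboloid_vimage[OF \<open>convex T\<close>])
  then have "r \<in> T" using assms(2) by auto
  then show ?thesis by (auto simp: T_def in_segment)
qed

text \<open>One inclusion is minimality of the hyperbolic hull. For the other, adjoining the ideal
  points to the image of \<open>CH\<close> gives a Euclidean convex set, and the adjoined points do
  not come from \<open>hyp_space\<close>.\<close>

lemma CH_eq_convex_hull:
  "CH (Some ` K) = {x \<in> hyp_space. paraboloid x \<in> convex hull (ideal ` K)}"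
proof
  have "closed_segment (ideal a) (ideal b) \<subseteq> convex hull (ideal ` K)" if "a \<in> K" "b \<in> K" for a b
    using that by (intro closed_segment_subset) (auto intro: hull_inc)
  then have "geodesics_union (Some ` K) \<subseteq> {x \<in> hyp_space. paraboloid x \<in> convex hull (ideal ` K)}"
    using geodesics_union_subset by blast
  then show "CH (Some ` K) \<subseteq> {x \<in> hyp_space. paraboloid x \<in> convex hull (ideal ` K)}"
    unfolding CH_def by (rule hull_minimal) (intro hyp_convex_paraboloid_vimage convex_convex_hull)
next
  let ?C = "paraboloid ` CH (Some ` K)"
  have "convex (?C \<union> ideal ` K)"
    unfolding convex_contains_open_segment
  proof (intro ballI)
    fix x y assume xy: "x \<in> ?C \<union> ideal ` K" "y \<in> ?C \<union> ideal ` K"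
    have "open_segment x y \<subseteq> ?C" if "x \<in> ?C" "y \<in> ?C"
      using convex_paraboloid_CH[of "Some ` K"] that unfolding convex_contains_open_segment by blast
    moreover have "open_segment x y \<subseteq> ?C" if "x \<in> ideal ` K" "y \<in> ?C"
      using that open_segment_ideal_CH_subset[of _ K y] by blast
    moreover have "open_segment x y \<subseteq> ?C" if "x \<in> ?C" "y \<in> ideal ` K"
      using that open_segment_ideal_CH_subset[of _ K x] unfolding open_segment_commute[of x y] by blast
    moreover have "open_segment x y \<subseteq> ?C" if "x \<in> ideal ` K" "y \<in> ideal ` K"
      using that open_segment_ideal_subset_CH[of _ K] by blast
    ultimately have "open_segment x y \<subseteq> ?C"
      using xy by blast
    then show "open_segment x y \<subseteq> ?C \<union> ideal ` K" by blast
  qed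
  then have hull: "convex hull (ideal ` K) \<subseteq> ?C \<union> ideal ` K"
    by (intro hull_minimal) auto
  show "{x \<in> hyp_space. paraboloid x \<in> convex hull (ideal ` K)} \<subseteq> CH (Some ` K)"
  proof clarify
    fix z t assume x: "(z, t) \<in> hyp_space" "paraboloid (z, t) \<in> convex hull (ideal ` K)"
    have "paraboloid (z, t) \<notin> ideal ` K"
      using x(1) by (auto simp: paraboloid_def hyp_space_def)
    with x hull have "paraboloid (z, t) \<in> ?C" by blast
    then show "(z, t) \<in> CH (Some ` K)"
      using inj_on_image_mem_iff[OF inj_on_paraboloid x(1) CH_subset_hyp_space] by blast
  qed
qed

section \<open>Circles and null sets\<close>

lemma open_hyp_space: "open hyp_space"
  unfolding hyp_space_def by (intro open_Collect_less continuous_intros)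

text \<open>Needed because \<open>emeasure\<close> is \<open>0\<close> on non-measurable sets.\<close>

lemma borel_CH:
  assumes "compact K"
  shows "CH (Some ` K) \<in> sets borel"
proof -
  have "compact (ideal ` K)"
    using assms by (intro compact_continuous_image continuous_intros)
  then have "closed (convex hull (ideal ` K))"
    by (intro compact_imp_closed compact_convex_hull)
  then have "closed (paraboloid -` (convex hull (ideal ` K)))"
    by (intro closed_vimage continuous_intros)
  moreover have "CH (Some ` K) = hyp_space \<inter> paraboloid -` (convex hull (ideal ` K))"
    unfolding CH_eq_convex_hull by blast
  ultimately show ?thesis
    using open_hyp_space by auto
qed

lemma sets_hyp_measure [simp]: "sets hyp_measure = sets borel"
  by (simp add: hyp_measure_def)

lemma measurable_hyp_density:
  "(\<lambda>p. if p \<in> hyp_space then ennreal (1 / snd p ^ 3) else 0) \<in> borel_measurable (borel :: point3 measure)"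
proof -
  have [measurable]: "(snd :: point3 \<Rightarrow> real) \<in> borel_measurable borel"
    by (intro borel_measurable_continuous_onI continuous_intros)
  have [measurable]: "hyp_space \<in> sets borel"
    using open_hyp_space by simp
  show ?thesis by measurable
qed

lemma null_sets_hyp_measure:
  assumes "N \<in> null_sets lborel"
  shows "N \<in> null_sets hyp_measure"
proof -
  have "absolutely_continuous lborel hyp_measure"
    unfolding hyp_measure_def
    using measurable_hyp_density by (intro absolutely_continuousI_density) simp
  with assms show ?thesis unfolding absolutely_continuous_def by blast
qed

text \<open>The equation of a circle is affine in \<open>z\<close> and its squared norm; a line
  gives a vertical plane.\<close>

lemma circle_imp_hyperplane:
  assumes "sphere_circle C" "Some ` K \<subseteq> C"
  shows "\<exists>n d. n \<noteq> 0 \<and> ideal ` K \<subseteq> {y. n \<bullet> y = d}"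
  using assms(1) unfolding sphere_circle_def
proof (elim disjE exE conjE)
  fix c r assume C: "0 < r" "C = Some ` sphere c r"
  have "(- 2 *\<^sub>R c, 1) \<bullet> ideal a = r\<^sup>2 - (norm c)\<^sup>2" if "a \<in> K" for a
  proof -
    have "a \<in> sphere c r" using assms(2) that C by auto
    then have "r\<^sup>2 = (norm (a - c))\<^sup>2" by (simp add: dist_norm norm_minus_commute)
    also have "\<dots> = (norm a)\<^sup>2 - 2 * (c \<bullet> a) + (norm c)\<^sup>2"
      unfolding power2_norm_eq_inner by (simp add: inner_diff_left inner_diff_right inner_commute)
    finally show ?thesis by (simp add: paraboloid_def)
  qed
  then have "(- 2 *\<^sub>R c, 1) \<noteq> (0 :: point3)"
    "ideal ` K \<subseteq> {y. (- 2 *\<^sub>R c, 1) \<bullet> y = r\<^sup>2 - (norm c)\<^sup>2}"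
    by (auto simp: zero_prod_def)
  then show ?thesis by blast
next
  fix a b assume C: "a \<noteq> b" "C = insert None (Some ` (affine hull {a, b}))"
  \<comment> \<open>The direction rotated by a right angle, hence normal to the line.\<close>
  define v where "v = \<i> * (b - a)"
  have "(v, 0) \<bullet> ideal k = v \<bullet> a" if "k \<in> K" for k
  proof -
    have "k \<in> affine hull {a, b}" using assms(2) that C by auto
    then obtain u where "k = a + u *\<^sub>R (b - a)"
      unfolding affine_hull_2_alt by auto
    moreover have "v \<bullet> (b - a) = 0"
      by (simp add: v_def inner_complex_def algebra_simps)
    ultimately show ?thesis by (simp add: paraboloid_def inner_add_right)
  qed
  then have "(v, 0) \<noteq> (0 :: point3)" "ideal ` K \<subseteq> {y. (v, 0) \<bullet> y = v \<bullet> a}"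
    using C by (auto simp: zero_prod_def v_def)
  then show ?thesis by blast
qed

text \<open>Planes with \<open>\<alpha> \<noteq> 0\<close> pull back to spheres centred on the
  boundary plane; \<open>s\<close> stands for the squared height and is 0 for the trace on the
  boundary.\<close>

lemma complete_square:
  fixes v z :: "'a :: real_inner"
  assumes "\<alpha> \<noteq> 0"
  shows "v \<bullet> z + \<alpha> * ((norm z)\<^sup>2 + s) = d \<longleftrightarrow>
    (norm (z + (1 / (2 * \<alpha>)) *\<^sub>R v))\<^sup>2 + s = d / \<alpha> + (norm v)\<^sup>2 / (4 * \<alpha>\<^sup>2)"
proof -
  have "(norm (z + (1 / (2 * \<alpha>)) *\<^sub>R v))\<^sup>2 = (norm z)\<^sup>2 + (v \<bullet> z) / \<alpha> + (norm v)\<^sup>2 / (4 * \<alpha>\<^sup>2)"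
    unfolding power2_norm_eq_inner
    by (simp add: inner_add_left inner_add_right inner_commute power2_eq_square)
  then have "v \<bullet> z + \<alpha> * ((norm z)\<^sup>2 + s) =
      \<alpha> * ((norm (z + (1 / (2 * \<alpha>)) *\<^sub>R v))\<^sup>2 + s - (norm v)\<^sup>2 / (4 * \<alpha>\<^sup>2))"
    using assms by (simp add: distrib_left)
  moreover have "\<alpha> * (A - B) = d \<longleftrightarrow> A = d / \<alpha> + B" for A B
    using assms by (auto simp: field_simps)
  ultimately show ?thesis by simp
qed

text \<open>The preimage of a plane lies in a plane or a sphere, both Lebesgue null.\<close>

lemma hyp_volume_subset_hyperplane:
  assumes "n \<noteq> 0" and "\<And>x. x \<in> A \<Longrightarrow> n \<bullet> paraboloid x = d"
  shows "hyp_volume A = 0"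
proof -
  obtain v \<alpha> where n: "n = (v, \<alpha>)" by (cases n)
  \<comment> \<open>Closedness makes \<open>N\<close> Borel, so that negligibility transfers to
    \<open>lborel\<close>.\<close>
  have "\<exists>N. closed N \<and> negligible N \<and> A \<subseteq> N"
  proof (cases "\<alpha> = 0")
    case True
    have "negligible {x. n \<bullet> x = d}"
      using assms(1) by (simp add: negligible_hyperplane)
    moreover have "closed {x. n \<bullet> x = d}"
      by (simp add: closed_hyperplane)
    moreover have "A \<subseteq> {x. n \<bullet> x = d}"
      using assms(2) True by (auto simp: n paraboloid_def)
    ultimately show ?thesis by blast
  next
    case False
    define c where "c = - (1 / (2 * \<alpha>)) *\<^sub>R v"
    define \<rho> where "\<rho> = d / \<alpha> + (norm v)\<^sup>2 / (4 * \<alpha>\<^sup>2)"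
    have "x \<in> sphere (c, 0) (sqrt \<rho>)" if "x \<in> A" for x
    proof -
      have "(norm (fst x - c))\<^sup>2 + (snd x)\<^sup>2 = \<rho>"
        using assms(2)[OF that] complete_square[OF False, of v "fst x" "(snd x)\<^sup>2" d]
        by (simp add: n paraboloid_def c_def \<rho>_def)
      then have "dist x (c, 0) = sqrt \<rho>"
        unfolding dist_prod_def by (simp add: dist_norm)
      then show ?thesis by (simp add: dist_commute)
    qed
    then show ?thesis
      by (intro exI[of _ "sphere (c, 0) (sqrt \<rho>)"] conjI closed_sphere negligible_sphere subsetI)
  qed
  then obtain N where N: "closed N" "negligible N" "A \<subseteq> N" by blast
  then have "N \<in> null_sets lborel"
    by (simp add: negligible_iff_null_sets null_sets_completion_iff)
  then have "N \<in> null_sets hyp_measure" by (rule null_sets_hyp_measure)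
  with N show ?thesis
    unfolding hyp_volume_def using emeasure_mono[OF \<open>A \<subseteq> N\<close>, of hyp_measure]
    by (auto simp: null_sets_def)
qed

lemma hyp_volume_CH_circle:
  assumes "sphere_circle C" "Some ` K \<subseteq> C"
  shows "hyp_volume (CH (Some ` K)) = 0"
proof -
  obtain n d where n: "n \<noteq> 0" "ideal ` K \<subseteq> {y. n \<bullet> y = d}"
    using circle_imp_hyperplane[OF assms] by blast
  then have "convex hull (ideal ` K) \<subseteq> {y. n \<bullet> y = d}"
    by (intro hull_minimal convex_hyperplane)
  with n(1) show ?thesis
    by (intro hyp_volume_subset_hyperplane[of n _ d]) (auto simp: CH_eq_convex_hull)
qed

text \<open>A plane meets the paraboloid above a line, a circle, a single point or nothing; the last
  two cases also fit into a circle.\<close>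

lemma hyperplane_imp_circle:
  assumes "n \<noteq> 0" "ideal ` K \<subseteq> {y. n \<bullet> y = d}"
  shows "\<exists>C. sphere_circle C \<and> Some ` K \<subseteq> C"
proof -
  obtain v \<alpha> where n: "n = (v, \<alpha>)" by (cases n)
  show ?thesis
  proof (cases "\<alpha> = 0")
    case True
    then have "v \<noteq> 0" using assms n by (auto simp: zero_prod_def)
    \<comment> \<open>The foot of the perpendicular from 0 to the line
      \<open>v \<bullet> z = d\<close>.\<close>
    define a where "a = (d / (norm v)\<^sup>2) *\<^sub>R v"
    have "z \<in> affine hull {a, a + \<i> * v}" if "z \<in> K" for z
    proof -
      have "v \<bullet> z = d" using assms(2) that True by (auto simp: n paraboloid_def)
      moreover have "v \<bullet> a = d"
        using \<open>v \<noteq> 0\<close> by (simp add: a_def power2_norm_eq_inner)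
      ultimately have orth: "v \<bullet> (z - a) = 0" by (simp add: inner_diff_right)
      define y where "y = z - a"
      \<comment> \<open>\<open>N / D\<close> is the coordinate of \<open>y\<close> along
        \<open>\<i> * v\<close>: \<open>N\<close> is their inner product and \<open>D\<close> the
        squared norm of \<open>v\<close>.\<close>
      define N D where "N = Re v * Im y - Im v * Re y" and "D = (Re v)\<^sup>2 + (Im v)\<^sup>2"
      define u where "u = N / D"
      have "D \<noteq> 0"
        using \<open>v \<noteq> 0\<close> by (simp add: D_def complex_eq_iff sum_power2_eq_zero_iff)
      have o: "Re v * Re y + Im v * Im y = 0"
        using orth by (simp add: y_def inner_complex_def)
      have "D * Re y = - N * Im v" "D * Im y = N * Re v"
        unfolding N_def D_def using o by algebra+
      then have "Re y = - u * Im v" "Im y = u * Re v"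
        using \<open>D \<noteq> 0\<close> by (simp_all add: u_def field_simps)
      then have "y = u *\<^sub>R (\<i> * v)"
        by (simp add: complex_eq_iff)
      moreover have "z = a + y" by (simp add: y_def)
      ultimately have "z = a + u *\<^sub>R ((a + \<i> * v) - a)" by simp
      then show ?thesis unfolding affine_hull_2_alt by blast
    qed
    then have "Some ` K \<subseteq> insert None (Some ` (affine hull {a, a + \<i> * v}))" by blast
    moreover have "sphere_circle (insert None (Some ` (affine hull {a, a + \<i> * v})))"
      unfolding sphere_circle_def using \<open>v \<noteq> 0\<close> by (intro disjI2 exI[of _ a] exI[of _ "a + \<i> * v"]) auto
    ultimately show ?thesis by blast
  next
    case False
    define c where "c = - (1 / (2 * \<alpha>)) *\<^sub>R v"
    define \<rho> where "\<rho> = d / \<alpha> + (norm v)\<^sup>2 / (4 * \<alpha>\<^sup>2)"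
    have K: "(dist c z)\<^sup>2 = \<rho>" if "z \<in> K" for z
    proof -
      have "n \<bullet> ideal z = d" using assms(2) that by auto
      then show ?thesis
        using complete_square[OF False, of v z 0 d]
        by (simp add: n paraboloid_def c_def \<rho>_def dist_norm norm_minus_commute[of _ z])
    qed
    show ?thesis
    proof (cases "\<rho> > 0")
      case True
      have "K \<subseteq> sphere c (sqrt \<rho>)"
        by (auto simp flip: K)
      moreover have "sphere_circle (Some ` sphere c (sqrt \<rho>))"
        unfolding sphere_circle_def using True by (intro disjI1 exI[of _ c] exI[of _ "sqrt \<rho>"]) auto
      ultimately show ?thesis by blast
    next
      \<comment> \<open>At most the point \<open>c\<close> remains, and the unit circle about
        \<open>c + 1\<close> passes through it.\<close>
      case False
      have "z = c" if "z \<in> K" for z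
        using K[OF that] False zero_le_power2[of "dist c z"] by auto
      then have "K \<subseteq> sphere (c + 1) 1"
        by (auto simp: dist_norm)
      moreover have "sphere_circle (Some ` sphere (c + 1) 1)"
        unfolding sphere_circle_def by (intro disjI1 exI[of _ "c + 1"] exI[of _ 1]) auto
      ultimately show ?thesis by blast
    qed
  qed
qed

text \<open>A convex set without interior lies in a hyperplane, which would give a circle containing
  \<open>K\<close>; so the Euclidean hull has interior, and this pulls back by continuity.\<close>

lemma not_circle_imp_ball_subset_CH:
  assumes "\<not> (\<exists>C. sphere_circle C \<and> Some ` K \<subseteq> C)"
  obtains x \<epsilon> where "0 < \<epsilon>" "ball x \<epsilon> \<subseteq> CH (Some ` K)"
proof -
  let ?H = "convex hull (ideal ` K)"
  have "interior ?H \<noteq> {}"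
  proof
    assume empty: "interior ?H = {}"
    obtain n d where n: "n \<noteq> 0" "?H \<subseteq> {y. n \<bullet> y = d}"
      by (rule empty_interior_subset_hyperplane[OF convex_convex_hull empty])
    have "ideal ` K \<subseteq> {y. n \<bullet> y = d}"
      using hull_subset n(2) by (rule order_trans)
    with assms show False using hyperplane_imp_circle[OF n(1)] by simp
  qed
  then obtain y where y: "y \<in> interior ?H" by blast
  have "?H \<subseteq> {y. 0 \<le> depth y}"
    by (intro hull_minimal convex_depth_nonneg) auto
  moreover obtain e where e: "e > 0" "ball y e \<subseteq> ?H"
    using y mem_interior by blast
  \<comment> \<open>A step downwards stays in the hull, where depth is nonnegative, so
    \<open>y\<close> itself has positive depth.\<close>
  moreover have "(fst y, snd y - e / 2) \<in> ball y e"
    using e by (cases y) (simp add: dist_Pair_Pair dist_real_def)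
  ultimately have "0 \<le> depth (fst y, snd y - e / 2)" by blast
  then have "0 < depth y" using e by (simp add: depth_def)
  then obtain x where x: "x \<in> hyp_space" "paraboloid x = y" by (rule depth_posE)
  have "open (hyp_space \<inter> paraboloid -` interior ?H)"
    by (intro open_Int open_hyp_space open_vimage open_interior continuous_intros)
  moreover have "x \<in> hyp_space \<inter> paraboloid -` interior ?H" using x y by simp
  ultimately obtain \<epsilon> where "\<epsilon> > 0" "ball x \<epsilon> \<subseteq> hyp_space \<inter> paraboloid -` interior ?H"
    using open_contains_ball by blast
  moreover have "hyp_space \<inter> paraboloid -` interior ?H \<subseteq> CH (Some ` K)"
    unfolding CH_eq_convex_hull using interior_subset by blast
  ultimately show ?thesis using that by blast
qed

section \<open>Extension of planar similarities\<close>

text \<open>The ratio is any positive real, so that every iterate of a contraction is an instance,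
  including the identity with ratio 1.\<close>

locale similarity =
  fixes S :: "complex \<Rightarrow> complex" and r :: real
  assumes pos: "0 < r" and dist_scale: "dist (S x) (S y) = r * dist x y"
begin

text \<open>The Poincare extension: scaling heights by the same \<open>r\<close> makes it a
  Euclidean similarity of ratio \<open>r\<close>, hence a hyperbolic isometry.\<close>

definition extension :: "point3 \<Rightarrow> point3" where
  "extension p = (S (fst p), r * snd p)"

lemma dist_extension: "dist (extension p) (extension q) = r * dist p q"
proof -
  have "(dist (S (fst p)) (S (fst q)))\<^sup>2 + (dist (r * snd p) (r * snd q))\<^sup>2 =
      r\<^sup>2 * ((dist (fst p) (fst q))\<^sup>2 + (dist (snd p) (snd q))\<^sup>2)"
  proof -
    have "dist (r * snd p) (r * snd q) = r * dist (snd p) (snd q)"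
      using pos by (simp add: dist_real_def abs_mult flip: right_diff_distrib)
    then show ?thesis by (simp add: dist_scale power_mult_distrib distrib_left)
  qed
  then show ?thesis
    using pos by (simp add: extension_def dist_prod_def real_sqrt_mult)
qed

lemma extension_in_hyp_space_iff [simp]: "extension p \<in> hyp_space \<longleftrightarrow> p \<in> hyp_space"
  using pos by (simp add: extension_def hyp_space_def zero_less_mult_iff)

lemma hyp_dist_extension [simp]: "hyp_dist (extension p) (extension q) = hyp_dist p q"
proof -
  have "snd (extension p) = r * snd p" "snd (extension q) = r * snd q"
    by (simp_all add: extension_def)
  then show ?thesis
    unfolding hyp_dist_def dist_extension using pos
    by (simp add: power_mult_distrib power2_eq_square mult.assoc)
qed

lemma tendsto_extension:
  assumes "(f \<longlongrightarrow> l) F"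
  shows "((\<lambda>x. extension (f x)) \<longlongrightarrow> extension l) F"
proof -
  have "((\<lambda>x. r * dist (f x) l) \<longlongrightarrow> r * 0) F"
    using assms by (intro tendsto_mult_left) (rule tendsto_dist_iff [THEN iffD1])
  then have "((\<lambda>x. dist (extension (f x)) (extension l)) \<longlongrightarrow> 0) F"
    by (simp add: dist_extension)
  then show ?thesis
    by (rule tendsto_dist_iff [THEN iffD2])
qed

text \<open>The points that \<open>extension\<close> sends into \<open>CH\<close> form a
  hyperbolically convex set containing all geodesics with ends in \<open>K\<close>, because the
  images of these geodesics again have ends in \<open>K\<close>.\<close>

lemma extension_CH:
  assumes "S ` K \<subseteq> K" "x \<in> CH (Some ` K)"
  shows "extension x \<in> CH (Some ` K)"
proof -
  let ?A = "{p \<in> hyp_space. extension p \<in> CH (Some ` K)}"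
  have "geodesics_union (Some ` K) \<subseteq> ?A"
  proof
    fix x assume "x \<in> geodesics_union (Some ` K)"
    then obtain \<gamma> s a b where g: "hyp_geodesic \<gamma>" "x = \<gamma> s" "a \<in> K" "b \<in> K"
      and lim: "(\<gamma> \<longlongrightarrow> (a, 0)) at_bot" "(\<gamma> \<longlongrightarrow> (b, 0)) at_top"
      unfolding geodesics_union_def tends_to_ideal_def by auto
    have "hyp_geodesic (\<lambda>t. extension (\<gamma> t))"
      using g(1) by (auto simp: hyp_geodesic_def)
    moreover have "((\<lambda>t. extension (\<gamma> t)) \<longlongrightarrow> (S a, 0)) at_bot"
      "((\<lambda>t. extension (\<gamma> t)) \<longlongrightarrow> (S b, 0)) at_top"
      using lim[THEN tendsto_extension] by (simp_all add: extension_def)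
    moreover have "S a \<in> K" "S b \<in> K" using assms g by auto
    ultimately have "extension x \<in> geodesics_union (Some ` K)"
      unfolding g(2) by (intro geodesics_unionI[where \<gamma> = "\<lambda>t. extension (\<gamma> t)"])
    then have "extension x \<in> CH (Some ` K)"
      unfolding CH_def by (rule hull_inc)
    moreover have "x \<in> hyp_space"
      using g by (auto simp: hyp_geodesic_def)
    ultimately show "x \<in> ?A" by blast
  qed
  moreover have "hyp_convex ?A"
    unfolding hyp_convex_def
  proof (intro conjI ballI subsetI)
    fix p q x assume pq: "p \<in> ?A" "q \<in> ?A" and x: "x \<in> hyp_segment p q"
    then have "extension x \<in> hyp_segment (extension p) (extension q)"
      by (simp add: hyp_segment_def)
    then have "extension x \<in> CH (Some ` K)"
      using hyp_convex_CH[of "Some ` K"] pq unfolding hyp_convex_def by blast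
    then show "x \<in> ?A"
      using x by (simp add: hyp_segment_def)
  qed auto
  ultimately have "CH (Some ` K) \<subseteq> ?A"
    unfolding CH_def[of "Some ` K"] by (rule hull_minimal)
  with assms show ?thesis by blast
qed

text \<open>Rescaled and translated to fix 0, \<open>S\<close> becomes an isometry, thus orthogonal
  and onto in finite dimension.\<close>

lemma surj_S: "surj S"
proof -
  define g where "g z = (1 / r) *\<^sub>R (S z - S 0)" for z
  have "dist (g x) (g y) = dist x y" for x y
  proof -
    have "dist (g x) (g y) = (1 / r) * dist (S x) (S y)"
      using pos by (simp add: g_def dist_norm flip: scaleR_diff_right)
    then show ?thesis using pos by (simp add: dist_scale)
  qed
  then have "orthogonal_transformation g"
    unfolding orthogonal_transformation_isometry by (simp add: g_def)
  then have "surj g" by (rule orthogonal_transformation_surj)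
  have "\<exists>x. z = S x" for z
  proof -
    obtain x where "g x = (1 / r) *\<^sub>R (z - S 0)"
      using \<open>surj g\<close> by (metis surjD)
    then show ?thesis using pos by (auto simp: g_def)
  qed
  then show ?thesis by blast
qed

text \<open>Surjectivity of \<open>S\<close> makes the image fill the whole ball of scaled
  radius.\<close>

lemma ball_extension_subset: "ball (extension p) (r * \<epsilon>) \<subseteq> extension ` ball p \<epsilon>"
proof
  fix q assume q: "q \<in> ball (extension p) (r * \<epsilon>)"
  obtain z where "fst q = S z" using surj_S by (metis surjD)
  then have eq: "q = extension (z, snd q / r)"
    using pos by (simp add: extension_def prod_eq_iff)
  have "r * dist p (z, snd q / r) < r * \<epsilon>"
    using q by (subst (asm) eq) (simp add: dist_extension)
  then show "q \<in> extension ` ball p \<epsilon>"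
    using eq pos by auto
qed

end

section \<open>Infinite volume from shrinking copies of a ball\<close>

lemma similarity_funpow:
  assumes "similarity S r"
  shows "similarity (S ^^ n) (r ^ n)"
proof (induction n)
  case (Suc n)
  interpret similarity S r by fact
  interpret n: similarity "S ^^ n" "r ^ n" by fact
  show ?case
    using pos by unfold_locales (simp_all add: dist_scale n.dist_scale)
qed (simp add: similarity_def)

text \<open>The density decreases with height, and heights in the ball are at most
  \<open>snd p + \<epsilon>\<close>. The bound depends only on the ratio of radius to height, so it
  is the same for all scaled copies.\<close>

lemma hyp_volume_ball_ge:
  assumes "0 < \<epsilon>" "ball p \<epsilon> \<subseteq> hyp_space"
  shows "ennreal (unit_ball_vol 3 * (\<epsilon> / (snd p + \<epsilon>)) ^ 3) \<le> hyp_volume (ball p \<epsilon>)"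
proof -
  have "p \<in> hyp_space" using assms by auto
  then have t: "snd p > 0" by (simp add: hyp_space_def)
  have "ennreal (unit_ball_vol 3 * (\<epsilon> / (snd p + \<epsilon>)) ^ 3) =
      ennreal (1 / (snd p + \<epsilon>) ^ 3) * emeasure lborel (ball p \<epsilon>)"
    using assms t by (simp add: emeasure_ball power_divide flip: ennreal_mult)
  also have "\<dots> = (\<integral>\<^sup>+ q. ennreal (1 / (snd p + \<epsilon>) ^ 3) * indicator (ball p \<epsilon>) q \<partial>lborel)"
    by (simp add: nn_integral_cmult_indicator)
  also have "\<dots> \<le> (\<integral>\<^sup>+ q. (if q \<in> hyp_space then ennreal (1 / snd q ^ 3) else 0) *
      indicator (ball p \<epsilon>) q \<partial>lborel)"
  proof (rule nn_integral_mono)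
    fix q :: point3
    have "ennreal (1 / (snd p + \<epsilon>) ^ 3) \<le> ennreal (1 / snd q ^ 3)" if "q \<in> ball p \<epsilon>"
    proof -
      have "0 < snd q" using that assms by (auto simp: hyp_space_def)
      moreover have "snd q \<le> snd p + \<epsilon>"
        using that dist_snd_le[of p q] by (simp add: dist_real_def)
      ultimately show ?thesis
        using power_mono[of "snd q" "snd p + \<epsilon>" 3] by (intro ennreal_leI frac_le) auto
    qed
    then show "ennreal (1 / (snd p + \<epsilon>) ^ 3) * indicator (ball p \<epsilon>) q \<le>
        (if q \<in> hyp_space then ennreal (1 / snd q ^ 3) else 0) * indicator (ball p \<epsilon>) q"
      using assms(2) by (auto simp: indicator_def)
  qed
  also have "\<dots> = hyp_volume (ball p \<epsilon>)"
    unfolding hyp_volume_def hyp_measure_def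
    using measurable_hyp_density by (subst emeasure_density) auto
  finally show ?thesis .
qed

text \<open>Continuity from above for the parts \<open>A n\<close> of the hull up to height
  \<open>r ^ n * h\<close>: they shrink to the empty set, yet each contains a ball of volume at
  least \<open>c\<close>.\<close>

lemma hyp_volume_CH_eq_infinity:
  assumes "compact K" "similarity S r" "r < 1" "S ` K \<subseteq> K"
    and "0 < \<epsilon>" "ball p \<epsilon> \<subseteq> CH (Some ` K)"
  shows "hyp_volume (CH (Some ` K)) = \<infinity>"
proof (rule ccontr)
  assume fin: "hyp_volume (CH (Some ` K)) \<noteq> \<infinity>"
  interpret similarity S r by fact
  define h where "h = snd p + \<epsilon>"
  define A where "A n = CH (Some ` K) \<inter> {q. snd q \<le> r ^ n * h}" for n
  define c where "c = ennreal (unit_ball_vol 3 * (\<epsilon> / h) ^ 3)"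
  have "p \<in> hyp_space" using assms CH_subset_hyp_space by force
  then have h: "h > 0" using assms by (simp add: h_def hyp_space_def)
  then have "c > 0" using assms by (simp add: c_def)
  have sets: "A n \<in> sets hyp_measure" for n
  proof -
    have "closed {q :: point3. snd q \<le> r ^ n * h}"
      by (intro closed_Collect_le continuous_intros)
    then show ?thesis
      using borel_CH[OF assms(1)] by (simp add: A_def)
  qed
  have "decseq A"
  proof (rule decseq_SucI)
    fix n
    have "r ^ Suc n * h \<le> r ^ n * h"
      using pos \<open>r < 1\<close> h by (intro mult_right_mono power_decreasing) auto
    then show "A (Suc n) \<subseteq> A n" unfolding A_def by auto
  qed
  have ge: "c \<le> emeasure hyp_measure (A n)" for n
  proof -
    interpret n: similarity "S ^^ n" "r ^ n" by (intro similarity_funpow assms)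
    have inv: "(S ^^ n) ` K \<subseteq> K"
      by (induction n) (use assms(4) in auto)
    let ?B = "ball (n.extension p) (r ^ n * \<epsilon>)"
    have B: "?B \<subseteq> CH (Some ` K)"
      using n.ball_extension_subset[of p \<epsilon>] n.extension_CH[OF inv] assms(6) by blast
    have "snd q \<le> r ^ n * h" if "q \<in> ?B" for q
      using that dist_snd_le[of "n.extension p" q]
      by (simp add: dist_real_def h_def n.extension_def distrib_left)
    with B have "?B \<subseteq> A n" by (auto simp: A_def)
    \<comment> \<open>Radius and height scale by the same factor, which cancels.\<close>
    have "c = ennreal (unit_ball_vol 3 * (r ^ n * \<epsilon> / (snd (n.extension p) + r ^ n * \<epsilon>)) ^ 3)"
      using pos by (simp add: c_def h_def n.extension_def flip: distrib_left)
    also have "\<dots> \<le> hyp_volume ?B"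
      using B CH_subset_hyp_space pos assms by (intro hyp_volume_ball_ge) auto
    also have "\<dots> \<le> emeasure hyp_measure (A n)"
      unfolding hyp_volume_def using \<open>?B \<subseteq> A n\<close> sets by (rule emeasure_mono)
    finally show ?thesis .
  qed
  have "(\<Inter>n. A n) = {}"
  proof (rule ccontr)
    assume "(\<Inter>n. A n) \<noteq> {}"
    then obtain q where q: "q \<in> A n" for n by blast
    then have "q \<in> hyp_space" using CH_subset_hyp_space by (auto simp: A_def)
    then have "0 < snd q" by (simp add: hyp_space_def)
    moreover have "(\<lambda>n. r ^ n * h) \<longlonglongrightarrow> 0 * h"
      using pos \<open>r < 1\<close> by (intro tendsto_intros LIMSEQ_power_zero) auto
    then have "snd q \<le> 0 * h"
      by (rule LIMSEQ_le_const) (use q in \<open>auto simp: A_def\<close>)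
    ultimately show False by simp
  qed
  \<comment> \<open>Continuity from above requires finite measures; this is where the assumption
    \<open>fin\<close> enters.\<close>
  moreover have "emeasure hyp_measure (A n) \<noteq> \<infinity>" for n
  proof -
    have "emeasure hyp_measure (A n) \<le> hyp_volume (CH (Some ` K))"
      unfolding hyp_volume_def using borel_CH[OF assms(1)] by (intro emeasure_mono) (auto simp: A_def)
    with fin show ?thesis by (auto simp: top_unique)
  qed
  ultimately have "(INF n. emeasure hyp_measure (A n)) = 0"
    using INF_emeasure_decseq[of A hyp_measure] sets \<open>decseq A\<close> by auto
  moreover have "c \<le> (INF n. emeasure hyp_measure (A n))"
    using ge by (rule INF_greatest)
  ultimately show False using \<open>c > 0\<close> by simp
qed

theorem theorem1p2:
  fixes K :: "complex set"
  assumes "self_similar K"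
  shows "(hyp_volume (CH (Some ` K)) = 0 \<or> hyp_volume (CH (Some ` K)) = \<infinity>) \<and>
         (hyp_volume (CH (Some ` K)) = 0 \<longleftrightarrow> (\<exists>C. sphere_circle C \<and> Some ` K \<subseteq> C))"
proof (cases "\<exists>C. sphere_circle C \<and> Some ` K \<subseteq> C")
  case True
  then have "hyp_volume (CH (Some ` K)) = 0"
    using hyp_volume_CH_circle by blast
  with True show ?thesis by simp
next
  case False
  obtain F where "compact K" and F: "\<forall>S\<in>F. contracting_similarity S" "K = (\<Union>S\<in>F. S ` K)"
    using assms unfolding self_similar_def by blast
  obtain p \<epsilon> where ball: "0 < \<epsilon>" "ball p \<epsilon> \<subseteq> CH (Some ` K)"
    using not_circle_imp_ball_subset_CH[OF False] .
  \<comment> \<open>For empty \<open>F\<close> the set \<open>K\<close> is empty and so lies in the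
    unit circle.\<close>
  have "F \<noteq> {}"
  proof
    assume "F = {}"
    with F(2) have "K = {}" by blast
    then have "Some ` K \<subseteq> Some ` sphere 0 1" by simp
    moreover have "sphere_circle (Some ` sphere 0 1)"
      unfolding sphere_circle_def by (intro disjI1 exI[of _ 0] exI[of _ 1]) auto
    ultimately show False using False by blast
  qed
  then obtain S where "S \<in> F" by blast
  then have "S ` K \<subseteq> K" using F(2) by blast
  obtain r where "0 < r" "r < 1" "\<forall>x y. dist (S x) (S y) = r * dist x y"
    using F(1) \<open>S \<in> F\<close> unfolding contracting_similarity_def by blast
  then have "similarity S r" by unfold_locales auto
  then have "hyp_volume (CH (Some ` K)) = \<infinity>"
    using hyp_volume_CH_eq_infinity \<open>compact K\<close> \<open>r < 1\<close> \<open>S ` K \<subseteq> K\<close> ball by blast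
  with False show ?thesis by simp
qed

end
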